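(* Let $R$ be an integral domain containing $\mathbb{Q}$ and let $\rho(t)$ be a formal power series over $R$ with constant term $1$. The two-parameter family $\mathcal{Q}_{\rho,\alpha}(t)^\beta$ (with $\alpha,\beta\in R$) contains all possible series obtained from $\rho(t)$ by repeatedly taking powers $f\mapsto f^\gamma$ ($\gamma\in R$) and applying the operator $f\mapsto f^*$. That is, every series obtained from $\rho$ by finitely many such operations, in any order, equals $\mathcal{Q}_{\rho,\alpha}(t)^\beta$ for some $\alpha,\beta\in R$.
   Context: For a series $1+f(t)$ with $f(0)=0$, $(1+f(t))^\gamma:=\sum_{k\ge0}\binom{\gamma}{k}f(t)^k$ with $\binom{\gamma}{k}=\gamma(\gamma-1)\cdots(\gamma-k+1)/k!$. For $\rho(t)=1+\rho_1t+\rho_2t^2+\cdots$ put $D_n(\gamma):=[t^n]\rho(t)^\gamma$; for $n\ge1$ this is a polynomial in $\gamma$ divisible by $\gamma$, so $D_n(\gamma)/\gamma$ is a polynomial in $\gamma$, well-defined for all $\gamma$ including $\gamma=0$. The general series associated to $\rho$ is $$\mathcal{Q}_{\rho,\alpha}(t):=1+\sum_{n=1}^\infty\frac{D_n(\alpha n+1)}{\alpha n+1}t^n.$$ The $*$ operation on a power series $f(t)$ with invertible constant term is $f^*(t):=G(t)/t$, where $G$ is the compositional inverse of $t f(t)$. *)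

theory Defs
  imports "HOL-Computational_Algebra.Computational_Algebra"
begin

definition rat_embedding :: "(rat \<Rightarrow> 'a::idom) \<Rightarrow> bool" where
  "rat_embedding \<iota> \<longleftrightarrow>
     inj \<iota> \<and> \<iota> 1 = 1 \<and> (\<forall>x y. \<iota> (x + y) = \<iota> x + \<iota> y) \<and> (\<forall>x y. \<iota> (x * y) = \<iota> x * \<iota> y)"

text \<open>
  The library's \<open>gchoose\<close> and \<open>fps_binomial\<close> need a division operation (respectively a field)
  on the coefficients. In an integral domain the quotient by \<open>k!\<close> is the unique solution of the
  equation below; it exists when the domain contains the rationals (\<open>fact_mult_binom\<close>).
\<close>

definition binom :: "'a::idom \<Rightarrow> nat \<Rightarrow> 'a" where
  "binom \<gamma> k = (THE b. of_nat (fact k) * b = (\<Prod>i<k. \<gamma> - of_nat i))"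

text \<open>
  \<open>fps_compose\<close> truncates the sum over \<open>k\<close> at \<open>k \<le> n\<close> in degree \<open>n\<close>, which loses nothing
  because \<open>f - 1\<close> has constant term \<open>0\<close>. For \<open>f\<close> with another constant term the value has no meaning.
\<close>

definition fps_gpow :: "'a::idom fps \<Rightarrow> 'a \<Rightarrow> 'a fps" where
  "fps_gpow f \<gamma> = Abs_fps (binom \<gamma>) oo (f - 1)"

text \<open>\<open>D_quot \<rho> n\<close> is the polynomial \<open>D\<^sub>n(\<gamma>)/\<gamma>\<close> for \<open>n \<ge> 1\<close> (existence and uniqueness: \<open>D_quot_ex1\<close>).\<close>

definition D_coeff :: "'a::idom fps \<Rightarrow> nat \<Rightarrow> 'a \<Rightarrow> 'a" where
  "D_coeff \<rho> n \<gamma> = fps_nth (fps_gpow \<rho> \<gamma>) n"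

definition D_quot :: "'a::idom fps \<Rightarrow> nat \<Rightarrow> 'a poly" where
  "D_quot \<rho> n = (THE q. \<forall>\<gamma>. D_coeff \<rho> n \<gamma> = \<gamma> * poly q \<gamma>)"

definition Q_series :: "'a::idom fps \<Rightarrow> 'a \<Rightarrow> 'a fps" where
  "Q_series \<rho> \<alpha> = Abs_fps (\<lambda>n. if n = 0 then 1 else poly (D_quot \<rho> n) (\<alpha> * of_nat n + 1))"

text \<open>
  The library's \<open>fps_inv\<close> needs a field; over a domain the compositional inverse of \<open>t f(t)\<close>
  exists and is unique when the constant term of \<open>f\<close> is invertible (\<open>is_comp_inverse_ex1\<close>).
\<close>

definition is_comp_inverse :: "'a::idom fps \<Rightarrow> 'a fps \<Rightarrow> bool" where
  "is_comp_inverse F G \<longleftrightarrow> fps_nth G 0 = 0 \<and> F oo G = fps_X \<and> G oo F = fps_X"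

definition fps_star :: "'a::idom fps \<Rightarrow> 'a fps" where
  "fps_star f = fps_shift 1 (THE G. is_comp_inverse (fps_X * f) G)"

text \<open>If \<open>\<rho>\<close> has constant term \<open>1\<close>, so has every generated series, hence both operations apply.\<close>

inductive_set generated :: "'a::idom fps \<Rightarrow> 'a fps set" for \<rho> where
  base: "\<rho> \<in> generated \<rho>"
| power: "f \<in> generated \<rho> \<Longrightarrow> fps_gpow f \<gamma> \<in> generated \<rho>"
| star: "f \<in> generated \<rho> \<Longrightarrow> fps_star f \<in> generated \<rho>"


text \<open>The definite descriptions above are well defined.\<close>

lemma rat_embedding_of_nat:
  assumes "rat_embedding \<iota>"
  shows "\<iota> (of_nat n) = of_nat n"
proof -
  have add: "\<iota> (x + y) = \<iota> x + \<iota> y" for x y using assms by (auto simp: rat_embedding_def)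
  have "\<iota> 0 = 0" using add[of 0 0] by (metis add.right_neutral add_left_cancel)
  moreover have "\<iota> 1 = 1" using assms by (auto simp: rat_embedding_def)
  ultimately show ?thesis by (induction n) (auto simp: add)
qed

lemma rat_embedding_fact:
  assumes "rat_embedding (\<iota> :: rat \<Rightarrow> 'a::idom)"
  shows "of_nat (fact k) * \<iota> (1 / fact k) = 1"
proof -
  have "(of_nat (fact k) :: 'a) * \<iota> (1 / fact k) = \<iota> (of_nat (fact k)) * \<iota> (1 / fact k)"
    using rat_embedding_of_nat[OF assms, of "fact k"] by simp
  also have "\<dots> = \<iota> (of_nat (fact k) * (1 / fact k))"
    using assms unfolding rat_embedding_def by metis
  also have "of_nat (fact k) * (1 / fact k) = (1 :: rat)" by simp
  also have "\<iota> 1 = 1" using assms by (simp add: rat_embedding_def)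
  finally show ?thesis .
qed

lemma binom_eq:
  assumes "rat_embedding \<iota>"
  shows "binom \<gamma> k = \<iota> (1 / fact k) * (\<Prod>i<k. \<gamma> - of_nat i)"
  unfolding binom_def
proof (rule the_equality)
  show "of_nat (fact k) * (\<iota> (1 / fact k) * (\<Prod>i<k. \<gamma> - of_nat i)) = (\<Prod>i<k. \<gamma> - of_nat i)"
    using rat_embedding_fact[OF assms, of k] by (simp flip: mult.assoc)
next
  fix b assume b: "of_nat (fact k) * b = (\<Prod>i<k. \<gamma> - of_nat i)"
  have "\<iota> (1 / fact k) * (of_nat (fact k) * b) = (of_nat (fact k) * \<iota> (1 / fact k)) * b"
    by (simp only: mult_ac)
  then show "b = \<iota> (1 / fact k) * (\<Prod>i<k. \<gamma> - of_nat i)"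
    by (simp only: b rat_embedding_fact[OF assms] mult_1_left)
qed

lemma fact_mult_binom:
  assumes "rat_embedding (\<iota> :: rat \<Rightarrow> 'a::idom)"
  shows "of_nat (fact k) * binom (\<gamma>::'a) k = (\<Prod>i<k. \<gamma> - of_nat i)"
  using rat_embedding_fact[OF assms, of k] by (simp add: binom_eq[OF assms] flip: mult.assoc)

lemma D_quot_ex1:
  assumes "rat_embedding (\<iota> :: rat \<Rightarrow> 'a::idom)" "n \<ge> 1"
  shows "\<exists>!q. \<forall>\<gamma>::'a. D_coeff \<rho> n \<gamma> = \<gamma> * poly q \<gamma>"
proof -
  define q where "q = (\<Sum>k=1..n. smult (\<iota> (1 / fact k) * fps_nth ((\<rho> - 1) ^ k) n)
    (\<Prod>i=1..<k. [:- of_nat i, 1:]))"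
  have split: "(\<Prod>i<k. \<gamma> - of_nat i) = \<gamma> * (\<Prod>i=1..<k. \<gamma> - of_nat i)" if "k \<ge> 1" for k and \<gamma> :: 'a
  proof -
    have "{..<k} = insert 0 {1..<k}" using that by auto
    then show ?thesis by simp
  qed
  have q: "D_coeff \<rho> n \<gamma> = \<gamma> * poly q \<gamma>" for \<gamma>
  proof -
    have "D_coeff \<rho> n \<gamma> = (\<Sum>k=0..n. binom \<gamma> k * fps_nth ((\<rho> - 1) ^ k) n)"
      by (simp add: D_coeff_def fps_gpow_def fps_compose_nth)
    also have "\<dots> = (\<Sum>k=1..n. binom \<gamma> k * fps_nth ((\<rho> - 1) ^ k) n)"
      using \<open>n \<ge> 1\<close> by (intro sum.mono_neutral_right) (auto simp: Suc_le_eq)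
    also have "\<dots> = (\<Sum>k=1..n. \<gamma> * (\<iota> (1 / fact k) * fps_nth ((\<rho> - 1) ^ k) n
        * (\<Prod>i=1..<k. \<gamma> - of_nat i)))"
      by (intro sum.cong refl) (simp add: binom_eq[OF assms(1)] split mult_ac)
    also have "\<dots> = \<gamma> * poly q \<gamma>"
      by (simp add: q_def poly_sum poly_prod sum_distrib_left)
    finally show ?thesis .
  qed
  have inf: "infinite (UNIV :: 'a set)"
  proof -
    have "inj \<iota>" using assms by (simp add: rat_embedding_def)
    then have "infinite (range \<iota>)"
      using infinite_UNIV_char_0[where ?'a = rat] by (simp add: finite_image_iff)
    then show ?thesis by (rule infinite_super[OF subset_UNIV])
  qed
  show ?thesis
  proof (rule ex1I[of _ q])
    show "\<forall>\<gamma>. D_coeff \<rho> n \<gamma> = \<gamma> * poly q \<gamma>" using q by blast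
  next
    fix q' assume q': "\<forall>\<gamma>. D_coeff \<rho> n \<gamma> = \<gamma> * poly q' \<gamma>"
    have "poly ([:0, 1:] * (q' - q)) \<gamma> = 0" for \<gamma>
      using q[of \<gamma>] q'[rule_format, of \<gamma>] by (simp add: algebra_simps)
    then have "[:0, 1:] * (q' - q) = 0"
      using poly_roots_finite[of "[:0, 1:] * (q' - q)"] inf by auto
    then show "q' = q" by simp
  qed
qed

lemma fps_left_comp_inverse:
  fixes a :: "'a::idom fps"
  assumes a0: "fps_nth a 0 = 0" and a1: "fps_nth a 1 dvd 1"
  shows "\<exists>g. fps_nth g 0 = 0 \<and> g oo a = fps_X"
proof -
  obtain v where v: "fps_nth a 1 * v = 1" using a1 by (metis dvdE)
  define step where "step = (\<lambda>h n.
    (fps_nth fps_X n - (\<Sum>i<n. h i * fps_nth (a ^ i) n)) * v ^ n)"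
  define h where "h = wfrec less_than step"
  have h: "h n = step h n" for n
  proof -
    have "h n = step (cut h less_than n) n"
      unfolding h_def by (rule wfrec[OF wf_less_than])
    also have "\<dots> = step h n"
      by (simp add: step_def cut_apply)
    finally show ?thesis .
  qed
  have "(Abs_fps h oo a) = fps_X"
  proof (rule fps_ext)
    fix n
    have "fps_nth (Abs_fps h oo a) n = (\<Sum>i<n. h i * fps_nth (a ^ i) n) + h n * fps_nth (a ^ n) n"
      by (simp add: fps_compose_nth atLeast0AtMost flip: lessThan_Suc_atMost)
    also have "h n * fps_nth (a ^ n) n
        = (fps_nth fps_X n - (\<Sum>i<n. h i * fps_nth (a ^ i) n)) * (fps_nth a 1 * v) ^ n"
      by (subst h) (simp add: step_def startsby_zero_power_nth_same[OF a0] power_mult_distrib mult_ac)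
    finally show "fps_nth (Abs_fps h oo a) n = fps_nth fps_X n" by (simp only: v) simp
  qed
  moreover have "fps_nth (Abs_fps h) 0 = 0" by (simp add: h[of 0] step_def)
  ultimately show ?thesis by blast
qed

lemma is_comp_inverse_ex1:
  fixes f :: "'a::idom fps"
  assumes "fps_nth f 0 dvd 1"
  shows "\<exists>!G. is_comp_inverse (fps_X * f) G"
proof -
  let ?a = "fps_X * f"
  have a: "fps_nth ?a 0 = 0" "fps_nth ?a 1 dvd 1" using assms by auto
  obtain g where g: "fps_nth g 0 = 0" "g oo ?a = fps_X"
    using fps_left_comp_inverse[OF a] by blast
  have "fps_nth (g oo ?a) 1 = fps_nth g 1 * fps_nth ?a 1"
    by (simp add: fps_compose_nth g(1))
  then have "fps_nth g 1 * fps_nth ?a 1 = 1" by (simp add: g(2))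
  then have "fps_nth g 1 dvd 1" by (metis dvd_triv_left)
  then obtain h where h: "fps_nth h 0 = 0" "h oo g = fps_X"
    using fps_left_comp_inverse[OF g(1)] by blast
  have "h = h oo (g oo ?a)" by (simp only: g(2) fps_compose_fps_X)
  also have "\<dots> = ?a"
    by (simp only: fps_compose_assoc[OF a(1) g(1)] h(2) fps_X_fps_compose_startby0[OF a(1)])
  finally have "is_comp_inverse ?a g"
    using g h by (simp only: is_comp_inverse_def simp_thms)
  moreover have "G = g" if "is_comp_inverse ?a G" for G
  proof -
    have "G = (g oo ?a) oo G"
      using that by (simp only: g(2) is_comp_inverse_def fps_X_fps_compose_startby0)
    also have "\<dots> = g oo (?a oo G)"
      using that by (intro fps_compose_assoc[symmetric] a(1)) (simp only: is_comp_inverse_def)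
    also have "\<dots> = g"
      using that by (simp only: is_comp_inverse_def fps_compose_fps_X)
    finally show ?thesis .
  qed
  ultimately show ?thesis by blast
qed

end

theory Submission
  imports Defs
begin

text \<open>
  Let \<open>w\<close> be the compositional inverse of \<open>t \<rho>\<^sup>-\<^sup>\<alpha>\<close>. Lagrange inversion shows that the coefficients
  \<open>D\<^sub>n(\<alpha> n + 1)/(\<alpha> n + 1)\<close> are exactly those of \<open>\<rho>(w(t))\<close>, so \<open>\<Q>\<^bsub>\<rho>,\<alpha>\<^esub> = \<rho> \<circ> w\<close>
  (\<open>Q_series_eq_compose\<close>). In this form the family is visibly closed under both operations.
  Powers only multiply \<open>\<beta>\<close>. For the star, put \<open>f = \<Q>\<^bsub>\<rho>,\<alpha>\<^esub>\<^sup>\<beta> = \<rho>\<^sup>\<beta> \<circ> w\<close>; since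
  \<open>t f \<circ> t \<rho>\<^sup>-\<^sup>\<alpha> = t \<rho>\<^sup>\<beta>\<^sup>-\<^sup>\<alpha>\<close>, the inverse of \<open>t f\<close> is \<open>t \<rho>\<^sup>-\<^sup>\<alpha> \<circ> w'\<close>, where \<open>w'\<close> inverts
  \<open>t \<rho>\<^sup>\<beta>\<^sup>-\<^sup>\<alpha>\<close> and hence belongs to the parameter \<open>\<alpha> - \<beta>\<close>. This simplifies to
  \<open>f\<^sup>* = \<Q>\<^bsub>\<rho>,\<alpha>-\<beta>\<^esub>\<^sup>-\<^sup>\<beta>\<close> (\<open>fps_star_Q_series\<close>). The series \<open>\<rho>\<close> itself is \<open>\<Q>\<^bsub>\<rho>,0\<^esub>\<close>.

  The laws of powers with exponents in the domain come from the differential equation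
  \<open>f y' = \<gamma> f' y\<close>, which in characteristic zero determines \<open>y\<close> from its constant term.
\<close>

section \<open>Characteristic zero\<close>

lemma rat_embedding_of_nat_eq_0_iff:
  assumes "rat_embedding (\<iota> :: rat \<Rightarrow> 'a::idom)"
  shows "(of_nat n :: 'a) = 0 \<longleftrightarrow> n = 0"
proof -
  have "inj \<iota>" using assms by (simp add: rat_embedding_def)
  then have "\<iota> (of_nat n) = \<iota> (of_nat 0) \<longleftrightarrow> n = 0" by (auto simp: inj_eq)
  then show ?thesis by (simp only: rat_embedding_of_nat[OF assms]) simp
qed

lemma rat_embedding_infinite_UNIV:
  assumes "rat_embedding (\<iota> :: rat \<Rightarrow> 'a::idom)"
  shows "infinite (UNIV :: 'a set)"
proof -
  have "inj \<iota>" using assms by (simp add: rat_embedding_def)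
  then have "infinite (range \<iota>)"
    using infinite_UNIV_char_0[where ?'a = rat] by (simp add: finite_image_iff)
  then show ?thesis by (rule infinite_super[OF subset_UNIV])
qed

section \<open>Powers with exponents in the domain\<close>

lemma binom_0:
  assumes "rat_embedding (\<iota> :: rat \<Rightarrow> 'a::idom)"
  shows "binom (\<gamma>::'a) 0 = 1"
  using fact_mult_binom[OF assms, of 0 \<gamma>] by simp

lemma fps_gpow_nth_0:
  assumes "rat_embedding (\<iota> :: rat \<Rightarrow> 'a::idom)"
  shows "fps_nth (fps_gpow f (\<gamma>::'a)) 0 = 1"
  by (simp add: fps_gpow_def binom_0[OF assms])

lemma binom_Suc:
  assumes "rat_embedding (\<iota> :: rat \<Rightarrow> 'a::idom)"
  shows "of_nat (Suc k) * binom (\<gamma>::'a) (Suc k) = (\<gamma> - of_nat k) * binom \<gamma> k"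
proof -
  have "of_nat (fact k) * (of_nat (Suc k) * binom \<gamma> (Suc k))
      = of_nat (fact (Suc k)) * binom \<gamma> (Suc k)"
    by (simp add: algebra_simps)
  also have "\<dots> = (\<Prod>i<k. \<gamma> - of_nat i) * (\<gamma> - of_nat k)"
    by (subst fact_mult_binom[OF assms]) simp
  also have "\<dots> = of_nat (fact k) * ((\<gamma> - of_nat k) * binom \<gamma> k)"
    by (subst fact_mult_binom[OF assms, symmetric]) (simp add: mult_ac)
  finally show ?thesis
    using rat_embedding_of_nat_eq_0_iff[OF assms, of "fact k"]
    by (simp only: mult_cancel_left) simp
qed

text \<open>Composition with \<open>f - 1\<close> turns the differential equation \<open>(1 + t) B' = \<gamma> B\<close> of the
  binomial series into that of \<open>f\<^sup>\<gamma>\<close>.\<close>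

lemma fps_deriv_gpow:
  fixes f :: "'a::idom fps"
  assumes emb: "rat_embedding (\<iota> :: rat \<Rightarrow> 'a)" and f0: "fps_nth f 0 = 1"
  shows "f * fps_deriv (fps_gpow f \<gamma>) = fps_const \<gamma> * fps_deriv f * fps_gpow f \<gamma>"
proof -
  let ?B = "Abs_fps (binom \<gamma>)"
  have z: "fps_nth (f - 1) 0 = 0" using f0 by simp
  have "(1 + fps_X) * fps_deriv ?B = fps_const \<gamma> * ?B"
  proof (rule fps_ext)
    fix n
    show "fps_nth ((1 + fps_X) * fps_deriv ?B) n = fps_nth (fps_const \<gamma> * ?B) n"
      using binom_Suc[OF emb, of n \<gamma>]
      by (cases n) (simp_all add: algebra_simps)
  qed
  then have "((1 + fps_X) * fps_deriv ?B) oo (f - 1) = (fps_const \<gamma> * ?B) oo (f - 1)"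
    by simp
  then have "f * (fps_deriv ?B oo (f - 1)) = fps_const \<gamma> * fps_gpow f \<gamma>"
    by (simp add: fps_compose_mult_distrib[OF z] fps_compose_add_distrib
        fps_X_fps_compose_startby0[OF z] fps_gpow_def)
  then show ?thesis
    by (simp add: fps_gpow_def fps_compose_deriv[OF z] mult_ac)
qed

lemma fps_ODE_unique:
  fixes f y z :: "'a::idom fps"
  assumes emb: "rat_embedding (\<iota> :: rat \<Rightarrow> 'a)" and f0: "fps_nth f 0 = 1"
    and y: "f * fps_deriv y = g * y" and z: "f * fps_deriv z = g * z"
    and init: "fps_nth y 0 = fps_nth z 0"
  shows "y = z"
proof -
  define d where "d = y - z"
  have d: "f * fps_deriv d = g * d" using y z by (simp add: d_def algebra_simps)
  have "fps_nth d n = 0" for n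
  proof (induction n rule: less_induct)
    case (less n)
    show ?case
    proof (cases n)
      case 0
      then show ?thesis using init by (simp add: d_def)
    next
      case (Suc m)
      have "fps_nth (f * fps_deriv d) m = (\<Sum>i=0..m. fps_nth f i * fps_nth (fps_deriv d) (m - i))"
        by (simp add: fps_mult_nth)
      also have "\<dots> = (\<Sum>i\<in>{0}. fps_nth f i * fps_nth (fps_deriv d) (m - i))"
        by (rule sum.mono_neutral_right) (auto simp: less.IH Suc)
      finally have "fps_nth (f * fps_deriv d) m = of_nat n * fps_nth d n"
        using f0 Suc by simp
      moreover have "fps_nth (g * d) m = 0"
        by (auto simp: fps_mult_nth less.IH Suc intro!: sum.neutral)
      ultimately show ?thesis
        using d rat_embedding_of_nat_eq_0_iff[OF emb, of n] Suc by simp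
    qed
  qed
  then have "d = 0" by (simp add: fps_eq_iff)
  then show ?thesis by (simp add: d_def)
qed

lemma fps_gpow_unique:
  fixes f y :: "'a::idom fps"
  assumes emb: "rat_embedding (\<iota> :: rat \<Rightarrow> 'a)" and f0: "fps_nth f 0 = 1"
    and y: "f * fps_deriv y = fps_const \<gamma> * fps_deriv f * y" and y0: "fps_nth y 0 = 1"
  shows "fps_gpow f \<gamma> = y"
  using fps_ODE_unique[OF emb f0 fps_deriv_gpow[OF emb f0, of \<gamma>] y] y0
  by (simp add: fps_gpow_nth_0[OF emb])

lemma fps_gpow_0:
  assumes "rat_embedding (\<iota> :: rat \<Rightarrow> 'a::idom)" and "fps_nth (f :: 'a fps) 0 = 1"
  shows "fps_gpow f 0 = 1"
  by (rule fps_gpow_unique[OF assms]) simp_all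

lemma fps_gpow_1:
  assumes "rat_embedding (\<iota> :: rat \<Rightarrow> 'a::idom)" and "fps_nth (f :: 'a fps) 0 = 1"
  shows "fps_gpow f 1 = f"
  by (rule fps_gpow_unique[OF assms]) (simp_all add: assms(2))

lemma fps_gpow_add:
  fixes f :: "'a::idom fps"
  assumes "rat_embedding (\<iota> :: rat \<Rightarrow> 'a)" and "fps_nth f 0 = 1"
  shows "fps_gpow f (\<gamma> + \<delta>) = fps_gpow f \<gamma> * fps_gpow f \<delta>"
proof (rule fps_gpow_unique[OF assms])
  let ?y = "fps_gpow f \<gamma>" and ?z = "fps_gpow f \<delta>"
  have "f * fps_deriv (?y * ?z) = (f * fps_deriv ?y) * ?z + ?y * (f * fps_deriv ?z)"
    by (simp add: algebra_simps)
  then show "f * fps_deriv (?y * ?z) = fps_const (\<gamma> + \<delta>) * fps_deriv f * (?y * ?z)"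
    by (simp only: fps_deriv_gpow[OF assms]) (simp add: algebra_simps flip: fps_const_add)
qed (simp add: fps_gpow_nth_0[OF assms(1)])

lemma fps_gpow_gpow:
  fixes f :: "'a::idom fps"
  assumes emb: "rat_embedding (\<iota> :: rat \<Rightarrow> 'a)" and f0: "fps_nth f 0 = 1"
  shows "fps_gpow (fps_gpow f \<gamma>) \<delta> = fps_gpow f (\<gamma> * \<delta>)"
proof -
  let ?g = "fps_gpow f \<gamma>"
  let ?y = "fps_gpow ?g \<delta>"
  have g0: "fps_nth ?g 0 = 1" by (rule fps_gpow_nth_0[OF emb])
  then have "?g \<noteq> 0" by (metis fps_zero_nth zero_neq_one)
  have "?g * (f * fps_deriv ?y) = f * (?g * fps_deriv ?y)" by (simp add: mult_ac)
  also have "\<dots> = fps_const \<delta> * (f * fps_deriv ?g) * ?y"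
    by (simp only: fps_deriv_gpow[OF emb g0]) (simp add: mult_ac)
  also have "\<dots> = ?g * (fps_const (\<gamma> * \<delta>) * fps_deriv f * ?y)"
    by (simp only: fps_deriv_gpow[OF emb f0]) (simp add: mult_ac flip: fps_const_mult)
  finally have "f * fps_deriv ?y = fps_const (\<gamma> * \<delta>) * fps_deriv f * ?y"
    using \<open>?g \<noteq> 0\<close> by simp
  then show ?thesis
    by (rule fps_gpow_unique[OF emb f0, symmetric]) (simp add: fps_gpow_nth_0[OF emb])
qed

lemma fps_gpow_power:
  fixes f :: "'a::idom fps"
  assumes "rat_embedding (\<iota> :: rat \<Rightarrow> 'a)" and "fps_nth f 0 = 1"
  shows "fps_gpow f \<gamma> ^ n = fps_gpow f (\<gamma> * of_nat n)"
proof (induction n)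
  case (Suc n)
  then show ?case using fps_gpow_add[OF assms, of \<gamma> "\<gamma> * of_nat n"] by (simp add: algebra_simps)
qed (simp add: fps_gpow_0[OF assms])

lemma fps_gpow_compose:
  fixes f w :: "'a::idom fps"
  assumes "fps_nth f 0 = 1" and w: "fps_nth w 0 = 0"
  shows "fps_gpow f \<gamma> oo w = fps_gpow (f oo w) \<gamma>"
  using assms by (simp add: fps_gpow_def fps_compose_assoc[symmetric] fps_compose_sub_distrib)

section \<open>The quotient of the coefficient polynomial by its argument\<close>

lemma fps_gpow_coeff_poly:
  fixes f M :: "'a::idom fps"
  assumes emb: "rat_embedding (\<iota> :: rat \<Rightarrow> 'a)"
  shows "\<exists>p. \<forall>\<gamma>. fps_nth (M * fps_gpow f \<gamma>) n = poly p \<gamma>"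
proof -
  define b where "b k = smult (\<iota> (1 / fact k)) (\<Prod>i<k. [:- of_nat i, 1:])" for k
  have b: "poly (b k) \<gamma> = binom \<gamma> k" for k \<gamma>
    by (simp add: b_def binom_eq[OF emb] poly_prod)
  define p where "p = (\<Sum>i=0..n. smult (fps_nth M i)
    (\<Sum>k=0..n - i. smult (fps_nth ((f - 1) ^ k) (n - i)) (b k)))"
  have "fps_nth (M * fps_gpow f \<gamma>) n = poly p \<gamma>" for \<gamma>
    by (simp add: p_def fps_gpow_def fps_mult_nth fps_compose_nth poly_sum b mult_ac)
  then show ?thesis by blast
qed

text \<open>The factor \<open>\<gamma>\<close> produced by differentiating \<open>\<rho>\<^sup>\<gamma>\<close> is the one that \<open>D_quot\<close> divides out.
  Both sides are polynomials in \<open>\<gamma>\<close>, so the identity also holds at \<open>\<gamma> = 0\<close>, where it cannot be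
  read off from \<open>D_coeff\<close>.\<close>

lemma D_quot_eq_deriv:
  fixes \<rho> :: "'a::idom fps"
  assumes emb: "rat_embedding (\<iota> :: rat \<Rightarrow> 'a)" and \<rho>0: "fps_nth \<rho> 0 = 1"
  shows "of_nat (Suc m) * poly (D_quot \<rho> (Suc m)) \<gamma>
    = fps_nth (fps_deriv \<rho> * fps_gpow \<rho> (\<gamma> - 1)) m"
proof -
  let ?q = "D_quot \<rho> (Suc m)"
  obtain p where p: "\<And>\<gamma>. fps_nth (fps_deriv \<rho> * fps_gpow \<rho> \<gamma>) m = poly p \<gamma>"
    using fps_gpow_coeff_poly[OF emb] by blast
  have q: "D_coeff \<rho> (Suc m) \<gamma> = \<gamma> * poly ?q \<gamma>" for \<gamma>
  proof -
    have "Suc m \<ge> 1" by simp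
    from theI'[OF D_quot_ex1[OF emb this, of \<rho>]] show ?thesis
      unfolding D_quot_def by blast
  qed
  have deriv: "fps_deriv (fps_gpow \<rho> \<gamma>) = fps_const \<gamma> * (fps_deriv \<rho> * fps_gpow \<rho> (\<gamma> - 1))" for \<gamma>
  proof -
    have "\<rho> \<noteq> 0" using \<rho>0 by auto
    have split: "fps_gpow \<rho> \<gamma> = \<rho> * fps_gpow \<rho> (\<gamma> - 1)"
      using fps_gpow_add[OF emb \<rho>0, of 1 "\<gamma> - 1"]
      by (simp only: fps_gpow_1[OF emb \<rho>0] add.commute[of 1] diff_add_cancel)
    have "\<rho> * fps_deriv (fps_gpow \<rho> \<gamma>)
        = fps_const \<gamma> * fps_deriv \<rho> * (\<rho> * fps_gpow \<rho> (\<gamma> - 1))"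
      by (simp only: fps_deriv_gpow[OF emb \<rho>0] split[symmetric])
    also have "\<dots> = \<rho> * (fps_const \<gamma> * (fps_deriv \<rho> * fps_gpow \<rho> (\<gamma> - 1)))"
      by (simp only: mult_ac)
    finally have "\<rho> * fps_deriv (fps_gpow \<rho> \<gamma>)
        = \<rho> * (fps_const \<gamma> * (fps_deriv \<rho> * fps_gpow \<rho> (\<gamma> - 1)))" .
    then show ?thesis using \<open>\<rho> \<noteq> 0\<close> by simp
  qed
  \<comment> \<open>The coefficients of the powers of \<open>\<rho>\<close> show \<open>\<gamma> r(\<gamma>) = 0\<close> for all \<open>\<gamma>\<close>; an infinite domain
    then gives \<open>r = 0\<close> as a polynomial.\<close>
  define r where "r = smult (of_nat (Suc m)) ?q - p \<circ>\<^sub>p [:-1, 1:]"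
  have "poly ([:0, 1:] * r) \<gamma> = 0" for \<gamma>
  proof -
    have "of_nat (Suc m) * (\<gamma> * poly ?q \<gamma>) = fps_nth (fps_deriv (fps_gpow \<rho> \<gamma>)) m"
      by (simp only: q[symmetric] D_coeff_def fps_deriv_nth Suc_eq_plus1[symmetric])
    also have "\<dots> = \<gamma> * poly p (\<gamma> - 1)"
      by (simp only: deriv fps_mult_left_const_nth p)
    finally have "\<gamma> * (of_nat (Suc m) * poly ?q \<gamma> - poly p (\<gamma> - 1)) = 0"
      by (simp only: right_diff_distrib mult.left_commute[of \<gamma>] diff_self)
    moreover have "poly r \<gamma> = of_nat (Suc m) * poly ?q \<gamma> - poly p (\<gamma> - 1)"
      by (simp add: r_def poly_pcompose)
    ultimately show ?thesis by simp
  qed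
  then have "[:0, 1:] * r = 0"
    using poly_roots_finite[of "[:0, 1:] * r"] rat_embedding_infinite_UNIV[OF emb] by auto
  then have "poly r \<gamma> = 0" by simp
  then show ?thesis by (simp add: r_def poly_pcompose p)
qed

section \<open>Lagrange inversion\<close>

lemma fps_compose_mult_nth:
  fixes a u M :: "'a::idom fps"
  assumes u0: "fps_nth u 0 = 0"
  shows "fps_nth ((a oo u) * M) n = (\<Sum>j=0..n. fps_nth a j * fps_nth (u ^ j * M) n)"
proof -
  have "fps_nth (a oo u) i = (\<Sum>j=0..n. fps_nth a j * fps_nth (u ^ j) i)" if "i \<le> n" for i
    unfolding fps_compose_nth
    by (rule sum.mono_neutral_left) (use that startsby_zero_power_prefix[OF u0] in auto)
  then have "fps_nth ((a oo u) * M) n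
      = (\<Sum>i=0..n. (\<Sum>j=0..n. fps_nth a j * fps_nth (u ^ j) i) * fps_nth M (n - i))"
    by (simp add: fps_mult_nth)
  also have "\<dots> = (\<Sum>j=0..n. \<Sum>i=0..n. fps_nth a j * fps_nth (u ^ j) i * fps_nth M (n - i))"
    by (subst sum.swap) (simp add: sum_distrib_right)
  finally show ?thesis by (simp add: fps_mult_nth sum_distrib_left mult.assoc)
qed

text \<open>With \<open>u = t/\<phi>\<close> this is the residue of \<open>u\<^sup>j\<^sup>-\<^sup>m\<^sup>-\<^sup>1 u'\<close>, which is the
  derivative of \<open>u\<^sup>j\<^sup>-\<^sup>m/(j - m)\<close> unless \<open>j = m\<close>. The proof clears the denominators
  so that no Laurent series appear.\<close>

lemma fps_residue_power_deriv:
  fixes \<phi> \<psi> :: "'a::idom fps"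
  assumes emb: "rat_embedding (\<iota> :: rat \<Rightarrow> 'a)" and inv: "\<psi> * \<phi> = 1" and "j \<le> m"
  shows "fps_nth ((fps_X * \<psi>) ^ j * (fps_deriv (fps_X * \<psi>) * \<phi> ^ Suc m)) m
    = (if j = m then 1 else 0)"
proof -
  obtain l where l: "m = j + l" using \<open>j \<le> m\<close> le_Suc_ex by blast
  have pj: "\<psi> ^ j * \<phi> ^ j = 1" using inv by (simp flip: power_mult_distrib)
  have "(fps_X * \<psi>) ^ j * (fps_deriv (fps_X * \<psi>) * \<phi> ^ Suc m)
      = fps_X ^ j * ((\<psi> ^ j * \<phi> ^ j) * (\<phi> ^ l * ((\<psi> * \<phi>) + fps_X * (fps_deriv \<psi> * \<phi>))))"
    by (simp add: l power_add algebra_simps)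
  also have "\<dots> = fps_X ^ j * (\<phi> ^ l + fps_X * (\<phi> ^ l * (fps_deriv \<psi> * \<phi>)))"
    by (simp only: pj inv mult_1_left distrib_left mult_1_right mult.left_commute[of _ fps_X])
  finally have eq: "fps_nth ((fps_X * \<psi>) ^ j * (fps_deriv (fps_X * \<psi>) * \<phi> ^ Suc m)) m
      = fps_nth (\<phi> ^ l + fps_X * (\<phi> ^ l * (fps_deriv \<psi> * \<phi>))) l"
    by (simp add: l fps_X_power_mult_nth)
  show ?thesis
  proof (cases l)
    case 0
    then show ?thesis using eq l by simp
  next
    case (Suc i)
    have "\<psi> * fps_deriv \<phi> + fps_deriv \<psi> * \<phi> = 0"
      using arg_cong[OF inv, of fps_deriv] by simp
    then have "fps_deriv \<psi> * \<phi> = - (\<psi> * fps_deriv \<phi>)"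
      by (simp add: add_eq_0_iff)
    then have "\<phi> ^ l * (fps_deriv \<psi> * \<phi>) = - ((\<psi> * \<phi>) * (\<phi> ^ i * fps_deriv \<phi>))"
      by (simp add: Suc mult_ac)
    then have d: "\<phi> ^ l * (fps_deriv \<psi> * \<phi>) = - (\<phi> ^ i * fps_deriv \<phi>)"
      by (simp add: inv)
    have "fps_deriv (\<phi> ^ l) = of_nat l * (\<phi> ^ i * fps_deriv \<phi>)"
      by (subst fps_deriv_power') (simp add: Suc mult_ac)
    then have "fps_nth (fps_deriv (\<phi> ^ l)) i = of_nat l * fps_nth (\<phi> ^ i * fps_deriv \<phi>) i"
      by (simp only: fps_of_nat[symmetric] fps_mult_left_const_nth)
    then have "of_nat l * fps_nth (\<phi> ^ l) l = of_nat l * fps_nth (\<phi> ^ i * fps_deriv \<phi>) i"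
      by (simp only: fps_deriv_nth Suc Suc_eq_plus1)
    then have "fps_nth (\<phi> ^ l) l = fps_nth (\<phi> ^ i * fps_deriv \<phi>) i"
      using rat_embedding_of_nat_eq_0_iff[OF emb, of l] Suc by (simp only: mult_cancel_left) simp
    moreover have "fps_nth (fps_X * g) l = fps_nth g i" for g :: "'a fps"
      by (simp add: Suc)
    ultimately have "fps_nth (\<phi> ^ l + fps_X * (\<phi> ^ l * (fps_deriv \<psi> * \<phi>))) l = 0"
      by (simp only: d fps_add_nth fps_neg_nth right_minus)
    moreover have "j \<noteq> m" using l Suc by simp
    ultimately show ?thesis by (simp only: eq if_False)
  qed
qed

text \<open>Differentiating \<open>H = (H \<circ> w) \<circ> t \<psi>\<close> expands \<open>H'\<close> in powers of \<open>t \<psi>\<close>; the residue above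
  then selects a single term.\<close>

theorem fps_lagrange_inversion:
  fixes H w \<phi> \<psi> :: "'a::idom fps"
  assumes emb: "rat_embedding (\<iota> :: rat \<Rightarrow> 'a)" and inv: "\<psi> * \<phi> = 1"
    and w: "is_comp_inverse (fps_X * \<psi>) w"
  shows "of_nat (Suc m) * fps_nth (H oo w) (Suc m) = fps_nth (fps_deriv H * \<phi> ^ Suc m) m"
proof -
  let ?u = "fps_X * \<psi>" and ?K = "H oo w"
  have u0: "fps_nth ?u 0 = 0" by simp
  have w0: "fps_nth w 0 = 0" and wu: "w oo ?u = fps_X"
    using w by (simp_all only: is_comp_inverse_def)
  have "H = ?K oo ?u"
    by (simp only: fps_compose_assoc[OF u0 w0, symmetric] wu fps_compose_fps_X)
  then have "fps_deriv H = (fps_deriv ?K oo ?u) * fps_deriv ?u"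
    by (metis fps_compose_deriv[OF u0])
  then have "fps_nth (fps_deriv H * \<phi> ^ Suc m) m
      = fps_nth ((fps_deriv ?K oo ?u) * (fps_deriv ?u * \<phi> ^ Suc m)) m"
    by (simp only: mult.assoc)
  also have "\<dots> = (\<Sum>j=0..m. fps_nth (fps_deriv ?K) j
      * fps_nth (?u ^ j * (fps_deriv ?u * \<phi> ^ Suc m)) m)"
    by (rule fps_compose_mult_nth[OF u0])
  also have "\<dots> = (\<Sum>j=0..m. if j = m then fps_nth (fps_deriv ?K) j else 0)"
    by (intro sum.cong refl) (subst fps_residue_power_deriv[OF emb inv], auto)
  also have "\<dots> = of_nat (Suc m) * fps_nth ?K (Suc m)" by simp
  finally show ?thesis by simp
qed

section \<open>The general series as a composition\<close>

lemma ex_is_comp_inverse_gpow: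
  fixes \<rho> :: "'a::idom fps"
  assumes "rat_embedding (\<iota> :: rat \<Rightarrow> 'a)"
  obtains w where "is_comp_inverse (fps_X * fps_gpow \<rho> \<gamma>) w"
  using is_comp_inverse_ex1[of "fps_gpow \<rho> \<gamma>"] by (auto simp: fps_gpow_nth_0[OF assms])

lemma Q_series_eq_compose:
  fixes \<rho> w :: "'a::idom fps"
  assumes emb: "rat_embedding (\<iota> :: rat \<Rightarrow> 'a)" and \<rho>0: "fps_nth \<rho> 0 = 1"
    and w: "is_comp_inverse (fps_X * fps_gpow \<rho> (- \<alpha>)) w"
  shows "Q_series \<rho> \<alpha> = \<rho> oo w"
proof (rule fps_ext)
  fix n
  show "fps_nth (Q_series \<rho> \<alpha>) n = fps_nth (\<rho> oo w) n"
  proof (cases n)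
    case 0
    then show ?thesis by (simp add: Q_series_def \<rho>0)
  next
    case (Suc m)
    have inv: "fps_gpow \<rho> (- \<alpha>) * fps_gpow \<rho> \<alpha> = 1"
      using fps_gpow_add[OF emb \<rho>0, of "- \<alpha>" \<alpha>] by (simp add: fps_gpow_0[OF emb \<rho>0])
    have "of_nat n * fps_nth (\<rho> oo w) n = fps_nth (fps_deriv \<rho> * fps_gpow \<rho> \<alpha> ^ n) m"
      unfolding Suc by (rule fps_lagrange_inversion[OF emb inv w])
    also have "\<dots> = of_nat n * poly (D_quot \<rho> n) (\<alpha> * of_nat n + 1)"
      by (simp only: fps_gpow_power[OF emb \<rho>0] Suc D_quot_eq_deriv[OF emb \<rho>0] add_diff_cancel_right')
    also have "\<dots> = of_nat n * fps_nth (Q_series \<rho> \<alpha>) n"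
      by (simp add: Q_series_def Suc)
    finally show ?thesis
      using rat_embedding_of_nat_eq_0_iff[OF emb, of n] Suc by (simp only: mult_cancel_left) simp
  qed
qed

lemma Q_series_0:
  fixes \<rho> :: "'a::idom fps"
  assumes emb: "rat_embedding (\<iota> :: rat \<Rightarrow> 'a)" and \<rho>0: "fps_nth \<rho> 0 = 1"
  shows "Q_series \<rho> 0 = \<rho>"
proof -
  have "is_comp_inverse (fps_X * fps_gpow \<rho> (- 0)) fps_X"
    by (simp add: is_comp_inverse_def fps_gpow_0[OF emb \<rho>0] fps_X_fps_compose_startby0)
  from Q_series_eq_compose[OF emb \<rho>0 this] show ?thesis by simp
qed

section \<open>The star operation on the family\<close>

lemma fps_star_eq:
  assumes "fps_nth (f :: 'a::idom fps) 0 dvd 1" and "is_comp_inverse (fps_X * f) (fps_X * g)"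
  shows "fps_star f = g"
proof -
  have "(THE G. is_comp_inverse (fps_X * f) G) = fps_X * g"
    using is_comp_inverse_ex1[OF assms(1)] assms(2) by (rule the1_equality)
  then show ?thesis by (simp add: fps_star_def fps_eq_iff)
qed

lemma fps_star_Q_series:
  fixes \<rho> :: "'a::idom fps"
  assumes emb: "rat_embedding (\<iota> :: rat \<Rightarrow> 'a)" and \<rho>0: "fps_nth \<rho> 0 = 1"
  shows "fps_star (fps_gpow (Q_series \<rho> \<alpha>) \<beta>) = fps_gpow (Q_series \<rho> (\<alpha> - \<beta>)) (- \<beta>)"
proof -
  let ?u = "fps_X * fps_gpow \<rho> (- \<alpha>)" and ?v = "fps_X * fps_gpow \<rho> (- (\<alpha> - \<beta>))"
  obtain w where w: "is_comp_inverse ?u w" using ex_is_comp_inverse_gpow[OF emb] .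
  obtain x where x: "is_comp_inverse ?v x" using ex_is_comp_inverse_gpow[OF emb] .
  have w0: "fps_nth w 0 = 0" and uw: "?u oo w = fps_X" and wu: "w oo ?u = fps_X"
    using w by (simp_all only: is_comp_inverse_def)
  have x0: "fps_nth x 0 = 0" and vx: "?v oo x = fps_X" and xv: "x oo ?v = fps_X"
    using x by (simp_all only: is_comp_inverse_def)
  have u0: "fps_nth ?u 0 = 0" and v0: "fps_nth ?v 0 = 0" by simp_all
  define f where "f = fps_gpow (Q_series \<rho> \<alpha>) \<beta>"
  define g where "g = fps_gpow (Q_series \<rho> (\<alpha> - \<beta>)) (- \<beta>)"
  have f: "f = fps_gpow \<rho> \<beta> oo w"
    by (simp add: f_def Q_series_eq_compose[OF emb \<rho>0 w] fps_gpow_compose[OF \<rho>0 w0])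
  have g: "g = fps_gpow \<rho> (- \<beta>) oo x"
    by (simp add: g_def Q_series_eq_compose[OF emb \<rho>0 x] fps_gpow_compose[OF \<rho>0 x0])
  have v_u: "?v = ?u * fps_gpow \<rho> \<beta>"
    using fps_gpow_add[OF emb \<rho>0, of "- \<alpha>" \<beta>] by (simp add: mult.assoc)
  have u_v: "?u = ?v * fps_gpow \<rho> (- \<beta>)"
    using fps_gpow_add[OF emb \<rho>0, of "- (\<alpha> - \<beta>)" "- \<beta>"] by (simp add: mult.assoc)
  have F: "fps_X * f = ?v oo w"
    by (simp only: v_u fps_compose_mult_distrib[OF w0, of ?u] uw f)
  have G: "fps_X * g = ?u oo x"
    by (subst u_v) (simp only: fps_compose_mult_distrib[OF x0, of ?v] vx g)
  have F0: "fps_nth (fps_X * f) 0 = 0" and G0: "fps_nth (fps_X * g) 0 = 0" by simp_all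
  have "(?v oo w) oo (?u oo x) = ((?v oo w) oo ?u) oo x"
    by (rule fps_compose_assoc[OF x0 u0])
  also have "(?v oo w) oo ?u = ?v"
    by (simp only: fps_compose_assoc[OF u0 w0, symmetric] wu fps_compose_fps_X)
  finally have FG: "(fps_X * f) oo (fps_X * g) = fps_X" by (simp only: F G vx)
  have "(?u oo x) oo (?v oo w) = ((?u oo x) oo ?v) oo w"
    by (rule fps_compose_assoc[OF w0 v0])
  also have "(?u oo x) oo ?v = ?u"
    by (simp only: fps_compose_assoc[OF v0 x0, symmetric] xv fps_compose_fps_X)
  finally have GF: "(fps_X * g) oo (fps_X * f) = fps_X" by (simp only: F G uw)
  have "is_comp_inverse (fps_X * f) (fps_X * g)"
    using G0 FG GF by (simp only: is_comp_inverse_def simp_thms)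
  moreover have "fps_nth f 0 dvd 1" by (simp add: f_def fps_gpow_nth_0[OF emb])
  ultimately have "fps_star f = g" by (intro fps_star_eq)
  then show ?thesis by (simp only: f_def g_def)
qed

theorem corollary8p3:
  fixes \<rho> f :: "'a::idom fps"
  assumes "\<exists>\<iota> :: rat \<Rightarrow> 'a. rat_embedding \<iota>"
    and "fps_nth \<rho> 0 = 1"
    and "f \<in> generated \<rho>"
  shows "\<exists>\<alpha> \<beta>. f = fps_gpow (Q_series \<rho> \<alpha>) \<beta>"
proof -
  obtain \<iota> :: "rat \<Rightarrow> 'a" where emb: "rat_embedding \<iota>" using assms(1) by blast
  note \<rho>0 = assms(2)
  have Q0: "fps_nth (Q_series \<rho> \<alpha>) 0 = 1" for \<alpha> by (simp add: Q_series_def)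
  from assms(3) show ?thesis
  proof induction
    case base
    have "\<rho> = fps_gpow (Q_series \<rho> 0) 1"
      by (simp add: Q_series_0[OF emb \<rho>0] fps_gpow_1[OF emb \<rho>0])
    then show ?case by blast
  next
    case (power f \<gamma>)
    then show ?case using fps_gpow_gpow[OF emb Q0] by blast
  next
    case (star f)
    then show ?case using fps_star_Q_series[OF emb \<rho>0] by blast
  qed
qed

end
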